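(* Let $L$ be a nilpotent symplectic alternating algebra of dimension $2n\geq 8$ with an ascending chain of isotropic ideals $$\{0\}=I_{0}<I_{1}<\cdots<I_{n},$$ where $\dim I_{j}=j$ for $j=1,\ldots,n$. Suppose $L$ is of maximal class. Then $$I_{2}=Z_{1}(L),\ I_{3}=Z_{2}(L),\ \ldots,\ I_{n-1}=Z_{n-2}(L),$$ $$I_{n-1}^{\perp}=Z_{n-1}(L),\ I_{n-2}^{\perp}=Z_{n}(L),\ \ldots,\ I_{2}^{\perp}=Z_{2n-4}(L).$$ Furthermore, $Z_{0}(L),Z_{1}(L),\ldots,Z_{2n-3}(L)$ are the unique ideals of $L$ of dimensions $0,2,3,\ldots,n-1,n+1,n+2,\ldots,2n-2,2n$ (respectively).
   Context: A symplectic alternating algebra over a field $F$ is a triple $(L,(\ ,\ ),\cdot)$ where $L$ is a finite-dimensional vector space over $F$ with a non-degenerate alternating bilinear form $(\ ,\ )$ and $\cdot$ is a bilinear alternating operation on $L$ (so $u\cdot u=0$ for all $u$) such that $(u\cdot v,w)=(v\cdot w,u)$ for all $u,v,w\in L$. Then $\dim L$ is even. For subspaces $U,V$, $UV$ is the subspace spanned by all products $u\cdot v$ with $u\in U,v\in V$. An ideal is a subspace $I$ with $IL\leq I$; $I^{\perp}$ is the orthogonal complement with respect to the form. A subspace is isotropic if the form vanishes on it. $L$ is nilpotent if there is a chain of ideals $\{0\}=J_{0}\leq\cdots\leq J_{m}=L$ with $J_{s}L\leq J_{s-1}$ for $s=1,\ldots,m$; the smallest possible $m$ is the nilpotence class.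 The upper central series is $Z_{0}(L)=\{0\}$, $Z_{k+1}(L)=\{x\in L: xL\subseteq Z_{k}(L)\}$. A nilpotent symplectic alternating algebra of dimension $2n\geq 8$ has class at most $2n-3$; it is of maximal class if its class equals $2n-3$. *)

theory Defs
  imports Complex_Main
begin

text \<open>
  The underlying space of the algebra is the whole type \<open>'v\<close>, made a vector space over
  the arbitrary field \<open>'f\<close> by \<open>scale\<close>. As the form is alternating, it suffices to
  state non-degeneracy in its first argument.
\<close>

locale symplectic_alternating_algebra = vector_space scale
  for scale :: "'f::field \<Rightarrow> 'v::ab_group_add \<Rightarrow> 'v" +
  fixes form :: "'v \<Rightarrow> 'v \<Rightarrow> 'f"
    and mul :: "'v \<Rightarrow> 'v \<Rightarrow> 'v"
  assumes finite_dimensional: "\<exists>B. finite B \<and> span B = UNIV"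
    and form_linear_left: "\<And>v. Vector_Spaces.linear scale (*) (\<lambda>u. form u v)"
    and form_linear_right: "\<And>u. Vector_Spaces.linear scale (*) (\<lambda>v. form u v)"
    and form_alternating: "\<And>u. form u u = 0"
    and form_nondegenerate: "\<And>u. (\<And>v. form u v = 0) \<Longrightarrow> u = 0"
    and mul_linear_left: "\<And>v. Vector_Spaces.linear scale scale (\<lambda>u. mul u v)"
    and mul_linear_right: "\<And>u. Vector_Spaces.linear scale scale (\<lambda>v. mul u v)"
    and mul_alternating: "\<And>u. mul u u = 0"
    and form_mul_cyclic: "\<And>u v w. form (mul u v) w = form (mul v w) u"

definition prod_space ::
  "('f::field \<Rightarrow> 'v::ab_group_add \<Rightarrow> 'v) \<Rightarrow> ('v \<Rightarrow> 'v \<Rightarrow> 'v) \<Rightarrow> 'v set \<Rightarrow> 'v set \<Rightarrow> 'v set"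
  where "prod_space scale mul U V = module.span scale {mul u v | u v. u \<in> U \<and> v \<in> V}"

definition alg_ideal ::
  "('f::field \<Rightarrow> 'v::ab_group_add \<Rightarrow> 'v) \<Rightarrow> ('v \<Rightarrow> 'v \<Rightarrow> 'v) \<Rightarrow> 'v set \<Rightarrow> bool"
  where "alg_ideal scale mul I \<longleftrightarrow>
    module.subspace scale I \<and> prod_space scale mul I UNIV \<subseteq> I"

definition orth_compl :: "('v \<Rightarrow> 'v \<Rightarrow> 'f::field) \<Rightarrow> 'v set \<Rightarrow> 'v set"
  where "orth_compl form U = {x. \<forall>u\<in>U. form x u = 0}"

definition isotropic :: "('v \<Rightarrow> 'v \<Rightarrow> 'f::field) \<Rightarrow> 'v set \<Rightarrow> bool"
  where "isotropic form U \<longleftrightarrow> (\<forall>u\<in>U. \<forall>v\<in>U. form u v = 0)"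

definition central_chain ::
  "('f::field \<Rightarrow> 'v::ab_group_add \<Rightarrow> 'v) \<Rightarrow> ('v \<Rightarrow> 'v \<Rightarrow> 'v) \<Rightarrow> nat \<Rightarrow> (nat \<Rightarrow> 'v set) \<Rightarrow> bool"
  where "central_chain scale mul m J \<longleftrightarrow>
    J 0 = {0} \<and> J m = UNIV \<and>
    (\<forall>s\<le>m. alg_ideal scale mul (J s)) \<and>
    (\<forall>s\<in>{1..m}. J (s - 1) \<subseteq> J s \<and> prod_space scale mul (J s) UNIV \<subseteq> J (s - 1))"

definition nilpotent_alg ::
  "('f::field \<Rightarrow> 'v::ab_group_add \<Rightarrow> 'v) \<Rightarrow> ('v \<Rightarrow> 'v \<Rightarrow> 'v) \<Rightarrow> bool"
  where "nilpotent_alg scale mul \<longleftrightarrow> (\<exists>m J. central_chain scale mul m J)"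

definition nilpotence_class ::
  "('f::field \<Rightarrow> 'v::ab_group_add \<Rightarrow> 'v) \<Rightarrow> ('v \<Rightarrow> 'v \<Rightarrow> 'v) \<Rightarrow> nat"
  where "nilpotence_class scale mul = (LEAST m. \<exists>J. central_chain scale mul m J)"

text \<open>Class \<open>2 * n - 3\<close> in dimension \<open>2 * n \<ge> 8\<close>.\<close>

definition maximal_class ::
  "('f::field \<Rightarrow> 'v::ab_group_add \<Rightarrow> 'v) \<Rightarrow> ('v \<Rightarrow> 'v \<Rightarrow> 'v) \<Rightarrow> bool"
  where "maximal_class scale mul \<longleftrightarrow>
    nilpotent_alg scale mul \<and> vector_space.dim scale (UNIV :: 'v set) \<ge> 8 \<and>
    nilpotence_class scale mul = vector_space.dim scale (UNIV :: 'v set) - 3"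

primrec upper_central :: "('v::zero \<Rightarrow> 'v \<Rightarrow> 'v) \<Rightarrow> nat \<Rightarrow> 'v set"
  where
    "upper_central mul 0 = {0}"
  | "upper_central mul (Suc k) = {x. \<forall>y. mul x y \<in> upper_central mul k}"

definition unique_ideal_of_dim ::
  "('f::field \<Rightarrow> 'v::ab_group_add \<Rightarrow> 'v) \<Rightarrow> ('v \<Rightarrow> 'v \<Rightarrow> 'v) \<Rightarrow> nat \<Rightarrow> 'v set \<Rightarrow> bool"
  where "unique_ideal_of_dim scale mul d I \<longleftrightarrow>
    alg_ideal scale mul I \<and> vector_space.dim scale I = d \<and>
    (\<forall>J. alg_ideal scale mul J \<and> vector_space.dim scale J = d \<longrightarrow> J = I)"

end

theory Submission
  imports Defs
begin

text \<open>
  Write \<open>Z k\<close> for the upper central series. Two mechanisms bound it. First, an ideal \<open>J\<close> not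
  contained in \<open>Z k\<close> meets \<open>Z (k + 1)\<close> outside \<open>Z k\<close>, and the cyclic symmetry of the form forces
  \<open>J \<inter> Z 1\<close> to have dimension at least two; hence every ideal of dimension \<open>d \<ge> 2\<close> lies in
  \<open>Z (d - 1)\<close>. Secondly, multiplication is self-adjoint up to the order of factors, so
  orthogonal complements of a central chain form a central chain again. This gives
  \<open>I j \<subseteq> Z (j - 1)\<close> and \<open>(I j)\<^sup>\<bottom> \<subseteq> Z (2 n - 2 - j)\<close>. The last proper term of the upper central
  series has codimension at least two, and in maximal class all its terms are distinct; counting
  dimensions downwards forces equality, except that \<open>Z (n - 2)\<close> could have
  dimension \<open>n\<close>. It would then be its own orthogonal complement, and dualising from there yields
  \<open>Z (2 n - 4) = L\<close>, a contradiction.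
\<close>

context symplectic_alternating_algebra
begin

abbreviation Z :: "nat \<Rightarrow> 'v set"
  where "Z \<equiv> upper_central mul"

abbreviation perp :: "'v set \<Rightarrow> 'v set"
  where "perp \<equiv> orth_compl form"

text \<open>A named basis is the parameter that \<open>finite_dimensional_vector_space\<close>
  expects, whereas the algebra only supplies the existence of a finite spanning set.\<close>

definition some_basis :: "'v set"
  where "some_basis = (SOME B. finite B \<and> independent B \<and> span B = UNIV)"

lemma some_basis: "finite some_basis \<and> independent some_basis \<and> span some_basis = UNIV"
proof -
  obtain S where S: "finite S" "span S = UNIV"
    using finite_dimensional by auto
  obtain B where B: "B \<subseteq> S" "independent B" "S \<subseteq> span B"
    using maximal_independent_subset[of S] by metis
  then have "finite B \<and> independent B \<and> span B = UNIV"
    using S by (metis finite_subset span_minimal subspace_span top.extremum_uniqueI)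
  then show ?thesis
    unfolding some_basis_def by (rule someI)
qed

end

sublocale symplectic_alternating_algebra \<subseteq> finite_dimensional_vector_space scale some_basis
  using some_basis by unfold_locales auto

context symplectic_alternating_algebra
begin

declare dim_UNIV [simp del]

section \<open>Bilinearity and self-adjointness\<close>

lemma form_add: "form (x + y) z = form x z + form y z" "form x (y + z) = form x y + form x z"
  using form_linear_left[of z] form_linear_right[of x] by (auto simp: Vector_Spaces.linear_iff)

lemma form_scale: "form (scale c x) z = c * form x z" "form x (scale c z) = c * form x z"
  using form_linear_left[of z] form_linear_right[of x] by (auto simp: Vector_Spaces.linear_iff)

lemma mul_add: "mul (x + y) z = mul x z + mul y z" "mul x (y + z) = mul x y + mul x z"
  using mul_linear_left[of z] mul_linear_right[of x] by (auto simp: Vector_Spaces.linear_iff)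

lemma mul_scale: "mul (scale c x) z = scale c (mul x z)" "mul x (scale c z) = scale c (mul x z)"
  using mul_linear_left[of z] mul_linear_right[of x] by (auto simp: Vector_Spaces.linear_iff)

lemma form_zero [simp]: "form 0 x = 0" "form x 0 = 0"
  using form_scale(1)[of 0 0 x] form_scale(2)[of x 0 0] by simp_all

lemma mul_zero [simp]: "mul 0 x = 0" "mul x 0 = 0"
  using mul_scale(1)[of 0 0 x] mul_scale(2)[of x 0 0] by simp_all

lemma form_swap: "form y x = - form x y"
proof -
  have "form (x + y) (x + y) = form y x + form x y"
    unfolding form_add by (simp add: form_alternating add.commute)
  then show ?thesis
    by (simp add: form_alternating eq_neg_iff_add_eq_0)
qed

lemma mul_swap: "mul y x = - mul x y"
proof -
  have "mul (x + y) (x + y) = mul y x + mul x y"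
    unfolding mul_add by (simp add: mul_alternating add.commute)
  then show ?thesis
    by (simp add: mul_alternating eq_neg_iff_add_eq_0)
qed

lemma form_uminus: "form (- x) y = - form x y" "form x (- y) = - form x y"
  using form_scale(1)[of "-1" x y] form_scale(2)[of x "-1" y] by simp_all

text \<open>Cyclicity and two sign changes. Right multiplications are thus self-adjoint, which is
  the source of the duality arguments below.\<close>

lemma form_mul_adjoint: "form (mul x y) z = form x (mul z y)"
proof -
  have "form (mul x y) z = form (mul y z) x"
    by (rule form_mul_cyclic)
  also have "\<dots> = form x (mul z y)"
    by (simp add: mul_swap[of z y] form_swap[of x] form_uminus)
  finally show ?thesis .
qed

lemma form_mul_self [simp]: "form (mul x y) y = 0" "form (mul x y) x = 0"
  using form_mul_cyclic[of x y y] form_mul_cyclic[of x x y] form_mul_cyclic[of x y x]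
  by (simp_all add: mul_alternating)

subsection \<open>Orthogonal complements\<close>

lemma subspace_orth_compl: "subspace (perp S)"
  by (auto simp: subspace_def orth_compl_def form_add form_scale)

lemma orth_compl_antimono: "S \<subseteq> T \<Longrightarrow> perp T \<subseteq> perp S"
  by (auto simp: orth_compl_def)

lemma subset_orth_compl_iff: "S \<subseteq> perp T \<longleftrightarrow> T \<subseteq> perp S"
proof -
  have "form x y = 0 \<longleftrightarrow> form y x = 0" for x y
    by (simp add: form_swap[of x y])
  then show ?thesis
    unfolding orth_compl_def by blast
qed

lemma orth_compl_span: "perp (span S) = perp S"
proof
  show "perp (span S) \<subseteq> perp S"
    by (simp add: orth_compl_antimono span_superset)
  have "span S \<subseteq> perp (perp S)"
    by (rule span_minimal) (simp_all add: subspace_orth_compl subset_orth_compl_iff[of S])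
  then show "perp S \<subseteq> perp (span S)"
    by (simp add: subset_orth_compl_iff)
qed

lemma orth_compl_UNIV: "perp UNIV = {0}"
  using form_nondegenerate by (auto simp: orth_compl_def)

text \<open>Each vector of \<open>B\<close> imposes one linear condition, which costs at most one
  dimension.\<close>

lemma dim_le_dim_Int_orth_compl:
  assumes "finite B" "subspace W"
  shows "dim W \<le> dim (W \<inter> perp B) + card B"
  using assms
proof (induction B)
  case empty
  then show ?case by (simp add: orth_compl_def)
next
  case (insert b B)
  let ?V = "W \<inter> perp B"
  let ?V' = "W \<inter> perp (insert b B)"
  have V': "?V' = {x \<in> ?V. form x b = 0}"
    by (auto simp: orth_compl_def)
  have sub: "subspace ?V"
    using insert.prems subspace_orth_compl subspace_inter by blast
  have "dim ?V \<le> dim ?V' + 1"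
  proof (cases "\<exists>w\<in>?V. form w b \<noteq> 0")
    case False
    then have "?V' = ?V" using V' by auto
    then show ?thesis by simp
  next
    case True
    then obtain w where w: "w \<in> ?V" "form w b \<noteq> 0" by blast
    have "v \<in> span (insert w ?V')" if v: "v \<in> ?V" for v
    proof -
      \<comment> \<open>The multiple of \<open>w\<close> that cancels the pairing of
        \<open>v\<close> with \<open>b\<close>.\<close>
      let ?k = "form v b / form w b"
      have "v - scale ?k w \<in> ?V"
        using v w sub by (intro subspace_diff subspace_scale)
      moreover have "form (v - scale ?k w) b = 0"
        using w(2) form_add(1)[of "v - scale ?k w" "scale ?k w" b] by (simp add: form_scale)
      ultimately have "v - scale ?k w \<in> span ?V'"
        unfolding V' by (intro span_base) simp
      then show ?thesis
        unfolding span_breakdown_eq by blast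
    qed
    then have "dim ?V \<le> dim (insert w ?V')"
      by (intro dim_mono) blast
    then show ?thesis
      by (auto simp: dim_insert split: if_splits)
  qed
  then show ?case
    using insert by simp
qed

text \<open>Conditions are counted twice: a basis \<open>C\<close> of \<open>U\<close> cuts
  \<open>perp U\<close> out of the whole space, and the remaining vectors of an extended basis cut
  \<open>perp U\<close> down to zero by non-degeneracy.\<close>

lemma dim_orth_compl:
  assumes U: "subspace U"
  shows "dim U + dim (perp U) = dim UNIV"
proof -
  obtain C where C: "C \<subseteq> U" "independent C" "U \<subseteq> span C" "card C = dim U"
    by (rule basis_exists)
  obtain D where D: "C \<subseteq> D" "independent D" "UNIV \<subseteq> span D"
    using maximal_independent_subset_extend[of C UNIV] C(2) by auto
  have fin: "finite D" "finite C" "finite (D - C)"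
    using C(2) D(2) finiteI_independent by blast+
  have cD: "card D = dim UNIV"
    using D by (simp add: basis_card_eq_dim)
  have "span C = U"
    using C U by (simp add: span_subspace)
  then have pC: "perp C = perp U"
    using orth_compl_span[of C] by simp
  have "dim UNIV \<le> dim (perp U) + dim U"
    using dim_le_dim_Int_orth_compl[OF fin(2) subspace_UNIV] C(4) pC by simp
  moreover have "perp U \<inter> perp (D - C) = perp (span D)"
    using D(1) unfolding orth_compl_span pC[symmetric] by (auto simp: orth_compl_def)
  then have "perp U \<inter> perp (D - C) = {0}"
    using D(3) orth_compl_UNIV by (simp add: top.extremum_unique)
  then have "dim (perp U) \<le> card (D - C)"
    using dim_le_dim_Int_orth_compl[OF fin(3) subspace_orth_compl[of U]] by simp
  then have "dim (perp U) \<le> dim UNIV - dim U"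
    using card_Diff_subset[OF fin(2) D(1)] cD C(4) by simp
  moreover have "dim U \<le> dim UNIV"
    by (simp add: dim_subset)
  ultimately show ?thesis by simp
qed

lemma orth_compl_orth_compl:
  assumes "subspace U"
  shows "perp (perp U) = U"
proof -
  have "U \<subseteq> perp (perp U)"
    by (simp add: subset_orth_compl_iff[of U])
  moreover have "dim (perp (perp U)) = dim U"
    using dim_orth_compl[OF assms] dim_orth_compl[OF subspace_orth_compl[of U]] by simp
  ultimately show ?thesis
    using subspace_dim_equal[OF assms subspace_orth_compl] by (metis order_refl)
qed

subsection \<open>Ideals and the upper central series\<close>

lemma prod_space_UNIV_subset_iff:
  assumes "subspace V"
  shows "prod_space scale mul U UNIV \<subseteq> V \<longleftrightarrow> (\<forall>x\<in>U. \<forall>y. mul x y \<in> V)"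
proof
  assume "prod_space scale mul U UNIV \<subseteq> V"
  then show "\<forall>x\<in>U. \<forall>y. mul x y \<in> V"
    unfolding prod_space_def by (blast intro: span_base)
next
  assume "\<forall>x\<in>U. \<forall>y. mul x y \<in> V"
  then show "prod_space scale mul U UNIV \<subseteq> V"
    unfolding prod_space_def by (intro span_minimal assms) blast
qed

lemma alg_ideal_iff:
  "alg_ideal scale mul J \<longleftrightarrow> subspace J \<and> (\<forall>x\<in>J. \<forall>y. mul x y \<in> J)"
  using prod_space_UNIV_subset_iff unfolding alg_ideal_def by blast

lemma alg_ideal_subspace: "alg_ideal scale mul J \<Longrightarrow> subspace J"
  by (simp add: alg_ideal_def)

lemma alg_ideal_mul: "alg_ideal scale mul J \<Longrightarrow> x \<in> J \<Longrightarrow> mul x y \<in> J"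
  by (simp add: alg_ideal_iff)

lemma alg_ideal_UNIV: "alg_ideal scale mul UNIV"
  by (simp add: alg_ideal_iff)

lemma alg_ideal_orth_compl: "alg_ideal scale mul J \<Longrightarrow> alg_ideal scale mul (perp J)"
  by (simp add: alg_ideal_iff subspace_orth_compl) (simp add: orth_compl_def form_mul_adjoint)

lemma subspace_upper_central: "subspace (Z k)"
  by (induction k) (auto simp: subspace_def mul_add mul_scale)

lemma upper_central_Suc_mono: "Z k \<subseteq> Z (Suc k)"
proof (induction k)
  case 0
  then show ?case by simp
next
  case (Suc k)
  show ?case
  proof
    fix x assume "x \<in> Z (Suc k)"
    then show "x \<in> Z (Suc (Suc k))"
      using Suc.IH unfolding upper_central.simps(2)[of mul "Suc k"] by auto
  qed
qed

lemma upper_central_mono: "i \<le> j \<Longrightarrow> Z i \<subseteq> Z j"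
  by (rule lift_Suc_mono_le) (rule upper_central_Suc_mono)

lemma alg_ideal_upper_central: "alg_ideal scale mul (Z k)"
  unfolding alg_ideal_iff
  using subspace_upper_central upper_central_Suc_mono[of k] by auto

text \<open>The upper central series climbs at least as fast as any central chain, so nilpotence and
  class can be read off from it alone.\<close>

lemma central_chain_subset_upper_central:
  assumes "central_chain scale mul m J" "s \<le> m"
  shows "J s \<subseteq> Z s"
  using assms(2)
proof (induction s)
  case 0
  then show ?case using assms(1) by (simp add: central_chain_def)
next
  case (Suc s)
  have "Suc s \<in> {1..m}" using Suc.prems by simp
  then have "prod_space scale mul (J (Suc s)) UNIV \<subseteq> J (Suc s - 1)"
    using assms(1) unfolding central_chain_def by blast
  then have "prod_space scale mul (J (Suc s)) UNIV \<subseteq> J s" by simp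
  moreover have "subspace (J s)"
    using assms(1) Suc.prems by (simp add: central_chain_def alg_ideal_subspace)
  ultimately show ?case
    using Suc prod_space_UNIV_subset_iff by auto
qed

lemma central_chain_upper_central:
  assumes "Z m = UNIV"
  shows "central_chain scale mul m Z"
proof -
  have "Z (s - 1) \<subseteq> Z s \<and> prod_space scale mul (Z s) UNIV \<subseteq> Z (s - 1)" if "s \<in> {1..m}" for s
    using that prod_space_UNIV_subset_iff[OF subspace_upper_central] upper_central_Suc_mono
    by (cases s) auto
  then show ?thesis
    using assms alg_ideal_upper_central by (simp add: central_chain_def)
qed

lemma nilpotence_class_eq:
  "nilpotence_class scale mul = (LEAST m. Z m = UNIV)"
proof -
  have "(\<exists>J. central_chain scale mul m J) \<longleftrightarrow> Z m = UNIV" for m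
  proof
    assume "\<exists>J. central_chain scale mul m J"
    then obtain J where J: "central_chain scale mul m J" ..
    then have "J m = UNIV" by (simp add: central_chain_def)
    then show "Z m = UNIV"
      using central_chain_subset_upper_central[OF J order_refl] by auto
  qed (use central_chain_upper_central in blast)
  then show ?thesis
    by (simp add: nilpotence_class_def)
qed

lemma nilpotent_upper_central:
  assumes "nilpotent_alg scale mul"
  obtains m where "Z m = UNIV"
proof -
  obtain m J where J: "central_chain scale mul m J"
    using assms unfolding nilpotent_alg_def by blast
  then have "J m = UNIV" by (simp add: central_chain_def)
  then have "Z m = UNIV"
    using central_chain_subset_upper_central[OF J order_refl] by auto
  then show ?thesis by (rule that)
qed

section \<open>Ideals against the upper central series\<close>

text \<open>Starting outside \<open>Z k\<close>, keep multiplying as long as some product stays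
  outside. Every product descends a level of the series, so this stops, at an element whose products
  all lie in \<open>Z k\<close>.\<close>

lemma ideal_meets_upper_central:
  assumes J: "alg_ideal scale mul J" "\<not> J \<subseteq> Z k" and m: "Z m = UNIV"
  obtains x where "x \<in> J" "x \<in> Z (Suc k)" "x \<notin> Z k"
proof -
  have "\<exists>x\<in>J. x \<in> Z (Suc k) \<and> x \<notin> Z k" if "x \<in> J" "x \<notin> Z k" "x \<in> Z m" for x m
    using that
  proof (induction m arbitrary: x)
    case 0
    then show ?case using subspace_0[OF subspace_upper_central[of k]] by simp
  next
    case (Suc m)
    show ?case
    proof (cases "\<forall>y. mul x y \<in> Z k")
      case True
      then show ?thesis using Suc.prems by auto
    next
      case False
      then obtain y where "mul x y \<notin> Z k" by blast
      then show ?thesis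
        using Suc.IH[of "mul x y"] Suc.prems alg_ideal_mul[OF J(1)] by auto
    qed
  qed
  then show ?thesis
    using J(2) m that by blast
qed

text \<open>
  If \<open>x L\<close> is contained in the line spanned by \<open>u\<close>, then \<open>x y = \<phi>(y) u\<close> with \<open>\<phi>(y) (u, y) = (x y, y) = 0\<close>
  for all \<open>y\<close>; a product of two linear functionals vanishes only if one of them does.
\<close>

lemma mul_eq_zero_if_line:
  assumes line: "\<And>y. mul x y \<in> span {u}"
  shows "mul x y = 0"
proof (rule ccontr)
  assume y: "mul x y \<noteq> 0"
  have ex: "\<exists>c. mul x y = scale c u" for y
    using line[of y] by (auto simp: span_singleton)
  obtain c where c: "mul x y = scale c u" using ex by blast
  with y have "c \<noteq> 0" "u \<noteq> 0" by auto
  then obtain z where z: "form u z \<noteq> 0"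
    using form_nondegenerate by blast
  have "form u y = 0"
    using form_mul_self(1)[of x y] \<open>c \<noteq> 0\<close> by (simp add: c form_scale)
  obtain d where d: "mul x z = scale d u" using ex by blast
  have "d = 0"
    using form_mul_self(1)[of x z] z by (simp add: d form_scale)
  then have "mul x (y + z) = scale c u"
    by (simp add: mul_add c d)
  then have "form (scale c u) (y + z) = 0"
    using form_mul_self(1)[of x "y + z"] by simp
  then show False
    using \<open>c \<noteq> 0\<close> \<open>form u y = 0\<close> z by (simp add: form_scale form_add)
qed

text \<open>Otherwise the intersection would be a line, and an element of \<open>J\<close> in
  \<open>Z 2\<close> but not in \<open>Z 1\<close> would have all its products on that line, hence
  be central by \<open>mul_eq_zero_if_line\<close>.\<close>

lemma two_le_dim_ideal_Int_center:
  assumes J: "alg_ideal scale mul J" and d: "2 \<le> dim J" and m: "Z m = UNIV"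
  shows "2 \<le> dim (J \<inter> Z 1)"
proof (rule ccontr)
  assume low: "\<not> 2 \<le> dim (J \<inter> Z 1)"
  have sub: "subspace (J \<inter> Z 1)"
    using alg_ideal_subspace[OF J] subspace_upper_central subspace_inter by blast
  have "\<not> J \<subseteq> Z 1"
    using low d by (metis inf.absorb1)
  then obtain x where x: "x \<in> J" "x \<in> Z (Suc 1)" "x \<notin> Z 1"
    using ideal_meets_upper_central[OF J _ m] by metis
  have "\<not> J \<subseteq> Z 0"
    using d by (metis dim_eq_0 not_numeral_le_zero upper_central.simps(1))
  then obtain u where u: "u \<in> J" "u \<in> Z 1" "u \<notin> Z 0"
    using ideal_meets_upper_central[OF J _ m] by (metis One_nat_def)
  have "span {u} = J \<inter> Z 1"
    using u low sub by (intro subspace_dim_equal subspace_span span_minimal) auto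
  moreover have "mul x y \<in> J \<inter> Z 1" for y
    using x alg_ideal_mul[OF J] by simp
  ultimately have "mul x y = 0" for y
    using mul_eq_zero_if_line by blast
  then show False
    using x(3) by simp
qed

text \<open>Level one already contributes two dimensions of \<open>J\<close>, and each further level
  at least one more until \<open>J\<close> is exhausted. The double gain at the start is why the
  index is one below the dimension.\<close>

lemma ideal_subset_upper_central:
  assumes J: "alg_ideal scale mul J" and d: "2 \<le> dim J" and m: "Z m = UNIV"
  shows "J \<subseteq> Z (dim J - 1)"
proof -
  have sub: "subspace (J \<inter> Z k)" for k
    using alg_ideal_subspace[OF J] subspace_upper_central subspace_inter by blast
  have "k + 2 \<le> dim J \<Longrightarrow> k + 2 \<le> dim (J \<inter> Z (Suc k))" for k
  proof (induction k)
    case 0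
    then show ?case using two_le_dim_ideal_Int_center[OF J d m] by simp
  next
    case (Suc k)
    show ?case
    proof (cases "J \<subseteq> Z (Suc k)")
      case True
      then have "J \<inter> Z (Suc (Suc k)) = J"
        using upper_central_Suc_mono by blast
      then show ?thesis using Suc.prems by (simp del: upper_central.simps)
    next
      case False
      then obtain x where "x \<in> J" "x \<in> Z (Suc (Suc k))" "x \<notin> Z (Suc k)"
        using ideal_meets_upper_central[OF J _ m] by metis
      then have "J \<inter> Z (Suc k) \<subset> J \<inter> Z (Suc (Suc k))"
        using upper_central_Suc_mono[of "Suc k"] by blast
      then have "dim (J \<inter> Z (Suc k)) < dim (J \<inter> Z (Suc (Suc k)))"
        using dim_psubset sub span_eq_iff by metis
      then show ?thesis using Suc by linarith
    qed
  qed
  \<comment> \<open>The largest admissible \<open>k\<close>, for which \<open>Suc k\<close> is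
    \<open>dim J - 1\<close>.\<close>
  from this[of "dim J - 2"] have "dim J \<le> dim (J \<inter> Z (dim J - 1))"
    using d by (simp add: Suc_diff_le[symmetric] numeral_2_eq_2 del: upper_central.simps)
  then have "J \<inter> Z (dim J - 1) = J"
    using subspace_dim_equal[OF sub alg_ideal_subspace[OF J]] by simp
  then show ?thesis by blast
qed

section \<open>Central factors and their duals\<close>

lemma span_insert_codim_one:
  assumes "subspace A" "subspace B" "A \<subseteq> B" "dim B \<le> Suc (dim A)" "b \<in> B" "b \<notin> A"
  shows "span (insert b A) = B"
proof (rule subspace_dim_equal)
  show "span (insert b A) \<subseteq> B"
    using assms by (intro span_minimal) auto
  have "b \<notin> span A" using assms(1,6) span_eq_iff by metis
  then show "dim B \<le> dim (span (insert b A))"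
    using assms(4) by (simp add: dim_insert)
qed (use assms in auto)

text \<open>The algebra acts nilpotently on \<open>B / A\<close>, and a nilpotent action on
  dimension at most one is zero. The proof picks \<open>b\<close> outside \<open>A\<close> at the
  lowest possible level, so that its products, one level lower, must fall into
  \<open>A\<close>.\<close>

lemma mul_ideal_codim_one:
  assumes A: "alg_ideal scale mul A" and B: "alg_ideal scale mul B" and AB: "A \<subseteq> B"
    and d: "dim B \<le> Suc (dim A)" and m: "Z m = UNIV" and x: "x \<in> B"
  shows "mul x y \<in> A"
proof (cases "B \<subseteq> A")
  case True
  then show ?thesis using x alg_ideal_mul[OF A] by blast
next
  case False
  define k where "k = (LEAST k. \<not> B \<inter> Z k \<subseteq> A)"
  have "\<not> B \<inter> Z m \<subseteq> A" using False m by simp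
  then have k: "\<not> B \<inter> Z k \<subseteq> A" and least: "\<And>i. i < k \<Longrightarrow> B \<inter> Z i \<subseteq> A"
    unfolding k_def by (rule LeastI, use not_less_Least in blast)
  from k obtain b where b: "b \<in> B" "b \<in> Z k" "b \<notin> A" by blast
  have "k \<noteq> 0"
    using b subspace_0[OF alg_ideal_subspace[OF A]] by (metis singletonD upper_central.simps(1))
  then obtain i where i: "k = Suc i" by (cases k) auto
  have "mul b y \<in> B \<inter> Z i"
    using b(1,2) alg_ideal_mul[OF B] by (simp add: i)
  then have by_A: "mul b y \<in> A" using least i by blast
  have "x \<in> span (insert b A)"
    using span_insert_codim_one[OF _ _ AB d b(1,3)] A B x alg_ideal_subspace by blast
  then obtain c where c: "x - scale c b \<in> A"
    unfolding span_breakdown_eq using alg_ideal_subspace[OF A] span_eq_iff by metis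
  have "mul x y = mul (x - scale c b) y + scale c (mul b y)"
    using mul_add(1)[of "x - scale c b" "scale c b" y] by (simp add: mul_scale)
  then show ?thesis
    using c by_A alg_ideal_mul[OF A] alg_ideal_subspace[OF A] by (simp add: subspace_add subspace_scale)
qed

text \<open>Adjointness reverses central factors: the complements of a central chain, taken in
  reverse order, are central again.\<close>

lemma mul_orth_compl:
  assumes "\<And>b y. b \<in> B \<Longrightarrow> mul b y \<in> A" "x \<in> perp A"
  shows "mul x y \<in> perp B"
  using assms by (simp add: orth_compl_def form_mul_adjoint)

text \<open>The complements of \<open>Z j\<close>, ..., \<open>Z 0\<close> ascend to the whole space
  with central factors, so each of these \<open>j\<close> steps costs at most one level.\<close>

lemma orth_compl_upper_central_subset:
  assumes "perp (Z j) \<subseteq> Z m"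
  shows "UNIV \<subseteq> Z (m + j)"
  using assms
proof (induction j arbitrary: m)
  case 0
  then show ?case by (simp add: orth_compl_def subset_iff)
next
  case (Suc j)
  have "mul x y \<in> perp (Z (Suc j))" if "x \<in> perp (Z j)" for x y
    using that by (rule mul_orth_compl[rotated]) simp
  then have "perp (Z j) \<subseteq> Z (Suc m)"
    using Suc.prems by auto
  from Suc.IH[OF this] show ?case by simp
qed

text \<open>In codimension one a single \<open>x\<close> would complement \<open>Z (Suc k)\<close>.
  Since \<open>x\<close> annihilates itself, its products come only from \<open>Z (Suc k)\<close>
  and lie in \<open>Z k\<close>, which puts \<open>x\<close> into \<open>Z (Suc k)\<close>.\<close>

lemma dim_upper_central_codim:
  assumes "Z (Suc k) \<noteq> UNIV" "Z (Suc (Suc k)) = UNIV"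
  shows "dim (Z (Suc k)) + 2 \<le> dim UNIV"
proof (rule ccontr)
  assume low: "\<not> ?thesis"
  obtain x where x: "x \<notin> Z (Suc k)" using assms(1) by blast
  have "span (insert x (Z (Suc k))) = UNIV"
    by (rule span_insert_codim_one) (use low x subspace_upper_central in \<open>auto simp del: upper_central.simps\<close>)
  have "mul x y \<in> Z k" for y
  proof -
    have "y \<in> span (insert x (Z (Suc k)))"
      by (simp only: \<open>span (insert x (Z (Suc k))) = UNIV\<close> UNIV_I)
    then obtain c where c: "y - scale c x \<in> Z (Suc k)"
      unfolding span_breakdown_eq using subspace_upper_central span_eq_iff by metis
    have "mul x y = mul x (y - scale c x)"
      using mul_add(2)[of x "y - scale c x" "scale c x"] by (simp add: mul_scale mul_alternating)
    also have "\<dots> = - mul (y - scale c x) x"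
      by (rule mul_swap)
    also have "\<dots> \<in> Z k"
      using c by (intro subspace_neg subspace_upper_central) simp
    finally show ?thesis .
  qed
  then show False using x by simp
qed

lemma upper_central_strict:
  assumes "Z k \<noteq> UNIV" "Z m = UNIV"
  shows "dim (Z k) < dim (Z (Suc k))"
proof -
  have "\<not> UNIV \<subseteq> Z k" using assms(1) by blast
  then obtain x where "x \<in> Z (Suc k)" "x \<notin> Z k"
    using ideal_meets_upper_central[OF alg_ideal_UNIV _ assms(2)] by metis
  then have "Z k \<subset> Z (Suc k)"
    using upper_central_Suc_mono by blast
  then show ?thesis
    using dim_psubset subspace_upper_central span_eq_iff by metis
qed

end

subsection \<open>Maximal class\<close>

text \<open>The class hypothesis is recorded as \<open>top\<close> and \<open>not_top\<close>: the
  series first fills the space at index \<open>2 * n - 3\<close>.\<close>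

locale maximal_class_ideal_chain = symplectic_alternating_algebra scale form mul
  for scale :: "'f::field \<Rightarrow> 'v::ab_group_add \<Rightarrow> 'v"
    and form :: "'v \<Rightarrow> 'v \<Rightarrow> 'f"
    and mul :: "'v \<Rightarrow> 'v \<Rightarrow> 'v" +
  fixes n :: nat and I :: "nat \<Rightarrow> 'v set"
  assumes dim_L: "dim UNIV = 2 * n"
    and n_ge: "4 \<le> n"
    and I_mono: "j < n \<Longrightarrow> I j \<subseteq> I (Suc j)"
    and I_ideal: "j \<le> n \<Longrightarrow> alg_ideal scale mul (I j)"
    and I_isotropic: "j \<le> n \<Longrightarrow> isotropic form (I j)"
    and dim_I: "j \<in> {1..n} \<Longrightarrow> dim (I j) = j"
    and top: "Z (2 * n - 3) = UNIV"
    and not_top: "Z (2 * n - 4) \<noteq> UNIV"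
begin

lemma subspace_I: "j \<le> n \<Longrightarrow> subspace (I j)"
  by (simp add: I_ideal alg_ideal_subspace)

lemma mul_I: "1 \<le> j \<Longrightarrow> j < n \<Longrightarrow> x \<in> I (Suc j) \<Longrightarrow> mul x y \<in> I j"
  by (rule mul_ideal_codim_one[OF _ _ I_mono _ top]) (auto simp: I_ideal dim_I)

lemma I_subset_upper_central: "2 \<le> j \<Longrightarrow> j \<le> n \<Longrightarrow> I j \<subseteq> Z (j - 1)"
  using ideal_subset_upper_central[OF I_ideal _ top, of j] by (simp add: dim_I)

lemma dim_orth_I: "j \<in> {1..n} \<Longrightarrow> dim (perp (I j)) = 2 * n - j"
  using dim_orth_compl[OF subspace_I, of j] by (simp add: dim_L dim_I)

text \<open>An isotropic subspace of half the dimension is Lagrangian.\<close>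

lemma orth_I_n: "perp (I n) = I n"
proof -
  have "I n \<subseteq> perp (I n)"
    using I_isotropic[of n] by (auto simp: isotropic_def orth_compl_def)
  moreover have "dim (perp (I n)) = dim (I n)"
    using n_ge by (simp add: dim_orth_I dim_I)
  ultimately show ?thesis
    using subspace_dim_equal[OF subspace_I subspace_orth_compl, of n "I n"] by simp
qed

lemma I_pred_n: "I (n - 1) \<subseteq> I n"
  using I_mono[of "n - 1"] n_ge by simp

text \<open>
  Modulo \<open>I (n - 1)\<close> its complement is a symplectic plane, spanned by a vector of \<open>I n\<close> and some
  \<open>b\<close>; as \<open>b y\<close> is orthogonal both to \<open>I n\<close> and to \<open>b\<close>, it vanishes in this plane.
\<close>

lemma mul_orth_I_pred_n:
  assumes x: "x \<in> perp (I (n - 1))"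
  shows "mul x y \<in> I (n - 1)"
proof -
  let ?P = "perp (I (n - 1))"
  have sub: "I n \<subseteq> ?P"
    using orth_compl_antimono[OF I_pred_n] orth_I_n by simp
  have dims: "dim ?P = Suc (dim (I n))"
    using n_ge by (simp add: dim_orth_I dim_I)
  then have "\<not> ?P \<subseteq> I n"
    using dim_subset[of ?P "I n"] by auto
  then obtain b where b: "b \<in> ?P" "b \<notin> I n" by blast
  have span: "span (insert b (I n)) = ?P"
    by (rule span_insert_codim_one) (use sub dims b subspace_I subspace_orth_compl in auto)
  have "mul b y \<in> perp (I n)"
    using mul_orth_compl[of "I n" "I (n - 1)"] mul_I[of "n - 1"] b n_ge by simp
  then have "mul b y \<in> perp (insert b (I n))"
    by (simp add: orth_compl_def)
  also have "\<dots> = perp ?P"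
    using span orth_compl_span by metis
  also have "\<dots> = I (n - 1)"
    by (simp add: orth_compl_orth_compl subspace_I)
  finally have bI: "mul b y \<in> I (n - 1)" .
  obtain c where c: "x - scale c b \<in> I n"
    using x unfolding span[symmetric] span_breakdown_eq by (metis order_refl span_eq_iff subspace_I)
  have "mul x y = mul (x - scale c b) y + scale c (mul b y)"
    using mul_add(1)[of "x - scale c b" "scale c b" y] by (simp add: mul_scale)
  then show ?thesis
    using bI c mul_I[of "n - 1"] n_ge by (simp add: subspace_add subspace_scale subspace_I)
qed

text \<open>The base passes from \<open>I (n - 1)\<close> straight to its complement, gaining two
  dimensions in one level; from there the duals of \<open>mul_I\<close> climb one level per
  dimension.\<close>

lemma orth_I_subset_upper_central:
  assumes "2 \<le> j" "j \<le> n - 1"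
  shows "perp (I j) \<subseteq> Z (2 * n - 2 - j)"
  using assms(2,1)
proof (induction j rule: inc_induct)
  case base
  have *: "2 * n - 2 - (n - 1) = Suc (n - 2)"
    using n_ge by simp
  have "I (n - 1) \<subseteq> Z (n - 2)"
    using I_subset_upper_central[of "n - 1"] n_ge by (simp add: numeral_2_eq_2)
  then show ?case
    using mul_orth_I_pred_n unfolding * by auto
next
  case (step j)
  have *: "2 * n - 2 - j = Suc (2 * n - 2 - Suc j)"
    using step by simp
  have "mul x y \<in> perp (I (Suc j))" if "x \<in> perp (I j)" for x y
    using that mul_orth_compl[of "I (Suc j)" "I j"] mul_I[of j] step by simp
  then show ?case
    using step unfolding * by auto
qed

section \<open>Dimension count from the top\<close>

lemma upper_central_neq_UNIV: "k \<le> 2 * n - 4 \<Longrightarrow> Z k \<noteq> UNIV"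
  using not_top upper_central_mono[of k "2 * n - 4"] by blast

lemma upper_central_dim_less: "k \<le> 2 * n - 4 \<Longrightarrow> dim (Z k) < dim (Z (Suc k))"
  using upper_central_strict[OF upper_central_neq_UNIV top] .

text \<open>\<open>Z (2 * n - 4)\<close> has codimension at least two, which is the codimension of
  \<open>perp (I 2)\<close>. Going down from there, strict growth removes at least one dimension per
  level, while \<open>orth_I_subset_upper_central\<close> permits the loss of at most one.\<close>

lemma orth_I_eq_upper_central:
  assumes "2 \<le> j" "j \<le> n - 1"
  shows "perp (I j) = Z (2 * n - 2 - j)"
  using assms
proof (induction j rule: dec_induct)
  case base
  obtain k where k: "2 * n - 4 = Suc k" "2 * n - 3 = Suc (Suc k)"
    using n_ge by (intro that[of "2 * n - 5"]) simp_all
  have "dim (Z (2 * n - 4)) \<le> 2 * n - 2"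
    using dim_upper_central_codim[of k] top not_top dim_L unfolding k by simp
  moreover have "perp (I 2) \<subseteq> Z (2 * n - 4)"
    using orth_I_subset_upper_central[of 2] n_ge by simp
  ultimately show ?case
    using subspace_dim_equal[OF subspace_orth_compl subspace_upper_central, of "I 2" "2 * n - 4"]
      dim_orth_I[of 2] n_ge by simp
next
  case (step j)
  let ?k = "2 * n - 2 - Suc j"
  have "2 * n - 2 - j = Suc ?k"
    using step by simp
  then have "dim (Z ?k) < dim (perp (I j))"
    using step upper_central_dim_less[of ?k] by simp
  then have "dim (Z ?k) \<le> dim (perp (I (Suc j)))"
    using step dim_orth_I[of j] dim_orth_I[of "Suc j"] by simp
  then show ?case
    using subspace_dim_equal[OF subspace_orth_compl subspace_upper_central]
      orth_I_subset_upper_central[of "Suc j"] step by simp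
qed

text \<open>Strict growth below \<open>Z (n - 1)\<close>, which has dimension \<open>n + 1\<close>,
  allows dimension \<open>n\<close> as well as \<open>n - 1\<close>; the main work is to exclude
  \<open>n\<close>.\<close>

lemma I_pred_n_eq_upper_central: "I (n - 1) = Z (n - 2)"
proof -
  let ?W = "Z (n - 2)"
  have IW: "I (n - 1) \<subseteq> ?W"
    using I_subset_upper_central[of "n - 1"] n_ge by (simp add: numeral_2_eq_2)
  have "2 \<le> n - 1" "2 * n - 2 - (n - 1) = Suc (n - 2)"
    using n_ge by simp_all
  then have "Z (Suc (n - 2)) = perp (I (n - 1))"
    using orth_I_eq_upper_central[of "n - 1"] by (metis order_refl)
  then have Z: "Z (Suc (n - 2)) = perp (I (n - 1))" "?W \<subseteq> perp (I (n - 1))"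
    using upper_central_Suc_mono[of "n - 2"] by blast+
  have "dim ?W < n + 1"
    using upper_central_dim_less[of "n - 2"] dim_orth_I[of "n - 1"] n_ge unfolding Z(1) by simp
  moreover have "dim ?W \<noteq> n"
  proof
    assume dW: "dim ?W = n"
    have dI: "dim (I (n - 1)) = n - 1"
      using n_ge dim_I by simp
    then have "\<not> ?W \<subseteq> I (n - 1)"
      using dW dim_subset[of ?W "I (n - 1)"] n_ge by auto
    then obtain w where w: "w \<in> ?W" "w \<notin> I (n - 1)" by blast
    have span: "span (insert w (I (n - 1))) = ?W"
      by (rule span_insert_codim_one) (use dW dI IW w n_ge subspace_I subspace_upper_central in auto)
    \<comment> \<open>As the form alternates, \<open>w\<close> is orthogonal to itself, so adjoining
      it to \<open>I (n - 1)\<close> keeps the space isotropic.\<close>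
    have "w \<in> perp (I (n - 1))"
      using w(1) Z(2) by blast
    moreover have "w \<in> perp {w}"
      by (simp add: orth_compl_def form_alternating)
    ultimately have "w \<in> perp ?W"
      unfolding span[symmetric] orth_compl_span by (simp add: orth_compl_def)
    moreover have "I (n - 1) \<subseteq> perp ?W"
      using Z(2) by (simp add: subset_orth_compl_iff)
    ultimately have "?W \<subseteq> perp ?W"
      unfolding span[symmetric] by (intro span_minimal subspace_orth_compl) (simp add: span)
    moreover have "dim (perp ?W) = n"
      using dim_orth_compl[OF subspace_upper_central, of "n - 2"] dW dim_L by simp
    ultimately have "perp ?W = ?W"
      using subspace_dim_equal[OF subspace_upper_central subspace_orth_compl] dW by (metis order_refl)
    \<comment> \<open>From level \<open>n - 2\<close>, another \<open>n - 2\<close> levels of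
      complements reach the whole space, one level too early.\<close>
    then have "UNIV \<subseteq> Z (n - 2 + (n - 2))"
      by (intro orth_compl_upper_central_subset) simp
    also have "n - 2 + (n - 2) = 2 * n - 4"
      using n_ge by simp
    finally show False
      using not_top by blast
  qed
  ultimately have "dim ?W \<le> dim (I (n - 1))"
    using dim_I[of "n - 1"] n_ge by simp
  then show ?thesis
    using subspace_dim_equal[OF subspace_I subspace_upper_central IW] by simp
qed

text \<open>The count by single dimensions resumes below the middle: strict growth bounds
  \<open>Z (j - 1)\<close> from above, \<open>I_subset_upper_central\<close> from below.\<close>

lemma I_eq_upper_central:
  assumes "2 \<le> j" "j \<le> n - 1"
  shows "I j = Z (j - 1)"
  using assms(2,1)
proof (induction j rule: inc_induct)
  case base
  then show ?case
    using I_pred_n_eq_upper_central by (simp add: numeral_2_eq_2)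
next
  case (step j)
  have "Suc (j - 1) = j"
    using step by simp
  then have "dim (Z (j - 1)) < dim (I (Suc j))"
    using step upper_central_dim_less[of "j - 1"] by simp
  then have "dim (Z (j - 1)) \<le> dim (I j)"
    using step.hyps step.prems dim_I[of j] dim_I[of "Suc j"] by simp
  then show ?case
    using subspace_dim_equal[OF subspace_I subspace_upper_central]
      I_subset_upper_central[of j] step by simp
qed

section \<open>Uniqueness of the ideals\<close>

text \<open>The general bound confines an ideal of dimension \<open>j\<close> to
  \<open>Z (j - 1)\<close>, which is now known to be \<open>I j\<close>, of the same
  dimension.\<close>

lemma unique_ideal_I:
  assumes j: "2 \<le> j" "j \<le> n - 1"
  shows "unique_ideal_of_dim scale mul j (I j)"
proof -
  have "J = I j" if J: "alg_ideal scale mul J" "dim J = j" for J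
  proof (rule subspace_dim_equal)
    show "J \<subseteq> I j"
      using ideal_subset_upper_central[OF J(1) _ top] J(2) j I_eq_upper_central by simp
  qed (use J j alg_ideal_subspace subspace_I dim_I in auto)
  then show ?thesis
    using j I_ideal dim_I unfolding unique_ideal_of_dim_def by auto
qed

text \<open>Taking complements is an involution on ideals that exchanges dimensions \<open>j\<close>
  and \<open>2 * n - j\<close>, so uniqueness carries over.\<close>

lemma unique_ideal_orth_I:
  assumes j: "2 \<le> j" "j \<le> n - 1"
  shows "unique_ideal_of_dim scale mul (2 * n - j) (perp (I j))"
proof -
  have "J = perp (I j)" if J: "alg_ideal scale mul J" "dim J = 2 * n - j" for J
  proof -
    have sub: "subspace J"
      using J(1) by (rule alg_ideal_subspace)
    have "dim (perp J) = j"
      using dim_orth_compl[OF sub] J(2) dim_L j by simp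
    then have "perp J = I j"
      using unique_ideal_I[OF j] alg_ideal_orth_compl[OF J(1)] unfolding unique_ideal_of_dim_def by blast
    then show ?thesis
      using orth_compl_orth_compl[OF sub] by simp
  qed
  then show ?thesis
    using j I_ideal alg_ideal_orth_compl dim_orth_I unfolding unique_ideal_of_dim_def by auto
qed

end

theorem theorem3p1:
  fixes scale :: "'f::field \<Rightarrow> 'v::ab_group_add \<Rightarrow> 'v"
    and form :: "'v \<Rightarrow> 'v \<Rightarrow> 'f"
    and mul :: "'v \<Rightarrow> 'v \<Rightarrow> 'v"
    and n :: nat
    and I :: "nat \<Rightarrow> 'v set"
  assumes "symplectic_alternating_algebra scale form mul"
    and "nilpotent_alg scale mul"
    and "vector_space.dim scale (UNIV :: 'v set) = 2 * n" and "2 * n \<ge> 8"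
    and "I 0 = {0}"
    and "\<forall>j<n. I j \<subset> I (Suc j)"
    and "\<forall>j\<le>n. alg_ideal scale mul (I j) \<and> isotropic form (I j)"
    and "\<forall>j\<in>{1..n}. vector_space.dim scale (I j) = j"
    and "maximal_class scale mul"
  shows "(\<forall>j\<in>{2..n - 1}. I j = upper_central mul (j - 1)) \<and>
    (\<forall>j\<in>{2..n - 1}. orth_compl form (I j) = upper_central mul (2 * n - 2 - j)) \<and>
    unique_ideal_of_dim scale mul 0 (upper_central mul 0) \<and>
    (\<forall>k\<in>{1..n - 2}. unique_ideal_of_dim scale mul (k + 1) (upper_central mul k)) \<and>
    (\<forall>k\<in>{n - 1..2 * n - 4}. unique_ideal_of_dim scale mul (k + 2) (upper_central mul k)) \<and>
    unique_ideal_of_dim scale mul (2 * n) (upper_central mul (2 * n - 3))"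
proof -
  interpret symplectic_alternating_algebra scale form mul by fact
  have n: "4 \<le> n" using assms(4) by simp
  have cls: "(LEAST m. Z m = UNIV) = 2 * n - 3"
    using assms(3,9) by (simp add: maximal_class_def nilpotence_class_eq)
  obtain m where "Z m = UNIV"
    using assms(2) by (rule nilpotent_upper_central)
  then have top: "Z (2 * n - 3) = UNIV"
    unfolding cls[symmetric] by (rule LeastI)
  \<comment> \<open>The bound on \<open>n\<close> keeps the truncated difference
    \<open>2 * n - 4\<close> strictly below the least index \<open>2 * n - 3\<close>.\<close>
  have "Z (2 * n - 4) \<noteq> UNIV"
    by (rule not_less_Least) (use cls n in simp)
  then interpret maximal_class_ideal_chain scale form mul n I
    using assms n top by unfold_locales auto
  have "unique_ideal_of_dim scale mul (k + 1) (Z k)" if "k \<in> {1..n - 2}" for k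
  proof -
    have "2 \<le> k + 1" "k + 1 \<le> n - 1" using that n by auto
    then show ?thesis
      using unique_ideal_I[of "k + 1"] I_eq_upper_central[of "k + 1"] by simp
  qed
  moreover have "unique_ideal_of_dim scale mul (k + 2) (Z k)" if "k \<in> {n - 1..2 * n - 4}" for k
  proof -
    \<comment> \<open>The index with \<open>perp (I j) = Z k\<close>. The dimension is
      \<open>k + 2\<close> here rather than \<open>k + 1\<close> because the series skips dimension
      \<open>n\<close>.\<close>
    define j where "j = 2 * n - 2 - k"
    have "2 \<le> j" "j \<le> n - 1" "k + 2 = 2 * n - j" "k = 2 * n - 2 - j"
      using that n by (auto simp: j_def)
    then show ?thesis
      using unique_ideal_orth_I[of j] orth_I_eq_upper_central[of j] by simp
  qed
  moreover have "unique_ideal_of_dim scale mul 0 (Z 0)"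
    using alg_ideal_upper_central[of 0] subspace_0[OF alg_ideal_subspace]
    by (auto simp: unique_ideal_of_dim_def)
  moreover have "unique_ideal_of_dim scale mul (2 * n) (Z (2 * n - 3))"
    unfolding top unique_ideal_of_dim_def
    using alg_ideal_UNIV dim_L subspace_dim_equal[OF alg_ideal_subspace subspace_UNIV] by auto
  ultimately show ?thesis
    using I_eq_upper_central orth_I_eq_upper_central by simp
qed

end
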